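(* Let $\Lambda=(\mathcal{L},\mathfrak{M},\models)$ be a satisfaction system. Then: (1) $\Lambda$ is eviction-compatible if and only if for every $\mathbb{M}\subseteq\mathfrak{M}$ at least one of the following holds: (i) $\mathbb{M}\in\mathrm{FR}(\Lambda)$; (ii) $\mathbb{M}$ has an immediate predecessor in the poset $(\mathrm{FR}(\Lambda)\cup\{\mathbb{M}\},\subsetneq)$; (iii) there is no $\mathbb{M}'\in\mathrm{FR}(\Lambda)$ with $\mathbb{M}\subseteq\mathbb{M}'$. (2) $\Lambda$ is reception-compatible if and only if for every $\mathbb{M}\subseteq\mathfrak{M}$ at least one of the following holds: (i) $\mathbb{M}\in\mathrm{FR}(\Lambda)$; (ii) $\mathbb{M}$ has an immediate successor in the poset $(\mathrm{FR}(\Lambda)\cup\{\mathbb{M}\},\subsetneq)$; (iii) there is no $\mathbb{M}'\in\mathrm{FR}(\Lambda)$ with $\mathbb{M}'\subseteq\mathbb{M}$.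
   Context: A satisfaction system is a triple $\Lambda=(\mathcal{L},\mathfrak{M},\models)$ where $\mathcal{L}$ is a set of formulae, $\mathfrak{M}$ a set of models, and $\models$ a relation between models and sets of formulae $B\subseteq\mathcal{L}$. $\mathrm{Mod}(B)=\{m\in\mathfrak{M}\mid m\models B\}$. $\mathrm{FR}(\Lambda)=\{X\subseteq\mathfrak{M}\mid X=\mathrm{Mod}(B)$ for some finite $B\subseteq\mathcal{L}\}$. For $\mathbb{M}\subseteq\mathfrak{M}$: $\mathrm{FRsubs}(\mathbb{M},\Lambda)=\{X\in\mathrm{FR}(\Lambda)\mid X\subseteq\mathbb{M}$ and no $Y\in\mathrm{FR}(\Lambda)$ has $X\subsetneq Y\subseteq\mathbb{M}\}$ and $\mathrm{FRsups}(\mathbb{M},\Lambda)=\{X\in\mathrm{FR}(\Lambda)\mid\mathbb{M}\subseteq X$ and no $Y\in\mathrm{FR}(\Lambda)$ has $\mathbb{M}\subseteq Y\subsetneq X\}$. $\Lambda$ is eviction-compatible if $\mathrm{FRsubs}(\mathrm{Mod}(B)\setminus\mathbb{M},\Lambda)\neq\emptyset$ for all finite $B\subseteq\mathcal{L}$ and all $\mathbb{M}\subseteq\mathfrak{M}$; it is reception-compatible if $\mathrm{FRsups}(\mathrm{Mod}(B)\cup\mathbb{M},\Lambda)\neq\emptyset$ for all finite $B\subseteq\mathcal{L}$ and all $\mathbb{M}\subseteq\mathfrak{M}$. In a poset $(P,\prec)$ (strict order), $x$ is an immediate predecessor of $y$ if $x\prec y$ and there is no $x'\in P$ with $x\prec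 x'\prec y$; $z$ is an immediate successor of $y$ if $y\prec z$ and there is no $z'\in P$ with $y\prec z'\prec z$. *)

theory Defs
  imports Main
begin

text \<open>Satisfaction is a relation between models and \<^emph>\<open>sets\<close> of formulae; no connection with the
  satisfaction of the individual formulae of such a set is presupposed.\<close>

record ('f, 'm) sat_system =
  formulae :: "'f set"
  models :: "'m set"
  sat :: "('m \<times> 'f set) set"

definition satisfaction_system :: "('f, 'm) sat_system \<Rightarrow> bool" where
  "satisfaction_system \<Lambda> \<longleftrightarrow> sat \<Lambda> \<subseteq> models \<Lambda> \<times> Pow (formulae \<Lambda>)"

definition Mod :: "('f, 'm) sat_system \<Rightarrow> 'f set \<Rightarrow> 'm set" where
  "Mod \<Lambda> B = {m \<in> models \<Lambda>. (m, B) \<in> sat \<Lambda>}"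

definition FR :: "('f, 'm) sat_system \<Rightarrow> 'm set set" where
  "FR \<Lambda> = {X. X \<subseteq> models \<Lambda> \<and> (\<exists>B. finite B \<and> B \<subseteq> formulae \<Lambda> \<and> X = Mod \<Lambda> B)}"

definition FRsubs :: "'m set \<Rightarrow> ('f, 'm) sat_system \<Rightarrow> 'm set set" where
  "FRsubs M \<Lambda> = {X \<in> FR \<Lambda>. X \<subseteq> M \<and> \<not> (\<exists>Y \<in> FR \<Lambda>. X \<subset> Y \<and> Y \<subseteq> M)}"

definition FRsups :: "'m set \<Rightarrow> ('f, 'm) sat_system \<Rightarrow> 'm set set" where
  "FRsups M \<Lambda> = {X \<in> FR \<Lambda>. M \<subseteq> X \<and> \<not> (\<exists>Y \<in> FR \<Lambda>. M \<subseteq> Y \<and> Y \<subset> X)}"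

definition eviction_compatible :: "('f, 'm) sat_system \<Rightarrow> bool" where
  "eviction_compatible \<Lambda> \<longleftrightarrow>
     (\<forall>B M. finite B \<and> B \<subseteq> formulae \<Lambda> \<and> M \<subseteq> models \<Lambda> \<longrightarrow> FRsubs (Mod \<Lambda> B - M) \<Lambda> \<noteq> {})"

definition reception_compatible :: "('f, 'm) sat_system \<Rightarrow> bool" where
  "reception_compatible \<Lambda> \<longleftrightarrow>
     (\<forall>B M. finite B \<and> B \<subseteq> formulae \<Lambda> \<and> M \<subseteq> models \<Lambda> \<longrightarrow> FRsups (Mod \<Lambda> B \<union> M) \<Lambda> \<noteq> {})"

text \<open>In the following two definitions, \<open>lt\<close> is the strict order of the poset with carrier \<open>P\<close>.\<close>

definition immediate_predecessor :: "'a set \<Rightarrow> ('a \<Rightarrow> 'a \<Rightarrow> bool) \<Rightarrow> 'a \<Rightarrow> 'a \<Rightarrow> bool" where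
  "immediate_predecessor P lt x y \<longleftrightarrow>
     x \<in> P \<and> y \<in> P \<and> lt x y \<and> \<not> (\<exists>x' \<in> P. lt x x' \<and> lt x' y)"

definition immediate_successor :: "'a set \<Rightarrow> ('a \<Rightarrow> 'a \<Rightarrow> bool) \<Rightarrow> 'a \<Rightarrow> 'a \<Rightarrow> bool" where
  "immediate_successor P lt z y \<longleftrightarrow>
     z \<in> P \<and> y \<in> P \<and> lt y z \<and> \<not> (\<exists>z' \<in> P. lt y z' \<and> lt z' z)"

end

theory Submission
  imports Defs
begin

text \<open>Two observations carry each half. First, the sets \<open>Mod \<Lambda> B - M\<close> are
  exactly the subsets of members of \<open>FR \<Lambda>\<close>, and the sets
  \<open>Mod \<Lambda> B \<union> M\<close> are exactly the sets of models that include a member of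
  \<open>FR \<Lambda>\<close>. So compatibility asks for a best approximation of each set not
  excluded by condition (iii); see \<open>eviction_compatible_iff\<close> and
  \<open>reception_compatible_iff\<close>. Second, a set in \<open>FR \<Lambda>\<close> is its own
  best approximation, while for any other set the best approximations from below or above are its
  immediate predecessors or successors; see \<open>FRsubs_nonempty_iff\<close> and
  \<open>FRsups_nonempty_iff\<close>.\<close>

lemma FRsubs_nonempty_iff:
  "FRsubs M \<Lambda> \<noteq> {} \<longleftrightarrow>
     M \<in> FR \<Lambda> \<or> (\<exists>X. immediate_predecessor (FR \<Lambda> \<union> {M}) (\<subset>) X M)"
proof (cases "M \<in> FR \<Lambda>")
  case True
  then have "M \<in> FRsubs M \<Lambda>"
    by (auto simp: FRsubs_def)
  with True show ?thesis by blast
next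
  case False
  \<comment> \<open>Since \<open>M\<close> is not in \<open>FR \<Lambda>\<close>, every member of
    \<open>FR \<Lambda>\<close> included in \<open>M\<close> is strictly included; and
    \<open>M\<close>, the only point added to the poset, cannot lie strictly between
    \<open>X\<close> and \<open>M\<close>.\<close>
  then have "X \<in> FRsubs M \<Lambda> \<longleftrightarrow> immediate_predecessor (FR \<Lambda> \<union> {M}) (\<subset>) X M" for X
    unfolding FRsubs_def immediate_predecessor_def by blast
  with False show ?thesis by blast
qed

lemma FRsups_nonempty_iff:
  "FRsups M \<Lambda> \<noteq> {} \<longleftrightarrow>
     M \<in> FR \<Lambda> \<or> (\<exists>Z. immediate_successor (FR \<Lambda> \<union> {M}) (\<subset>) Z M)"
proof (cases "M \<in> FR \<Lambda>")
  case True
  then have "M \<in> FRsups M \<Lambda>"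
    by (auto simp: FRsups_def)
  with True show ?thesis by blast
next
  case False
  then have "Z \<in> FRsups M \<Lambda> \<longleftrightarrow> immediate_successor (FR \<Lambda> \<union> {M}) (\<subset>) Z M" for Z
    unfolding FRsups_def immediate_successor_def by blast
  with False show ?thesis by blast
qed

lemma FR_eq: "FR \<Lambda> = {Mod \<Lambda> B |B. finite B \<and> B \<subseteq> formulae \<Lambda>}"
  by (auto simp: FR_def Mod_def)

lemma FR_subset_models: "X \<in> FR \<Lambda> \<Longrightarrow> X \<subseteq> models \<Lambda>"
  by (simp add: FR_def)

text \<open>Removing models from a member of \<open>FR \<Lambda>\<close> can produce any of its
  subsets and nothing else.\<close>

lemma eviction_compatible_iff:
  "eviction_compatible \<Lambda> \<longleftrightarrow>
     (\<forall>M \<subseteq> models \<Lambda>. (\<exists>M' \<in> FR \<Lambda>. M \<subseteq> M') \<longrightarrow> FRsubs M \<Lambda> \<noteq> {})"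
proof -
  have "eviction_compatible \<Lambda> \<longleftrightarrow>
      (\<forall>M' \<in> FR \<Lambda>. \<forall>N \<subseteq> models \<Lambda>. FRsubs (M' - N) \<Lambda> \<noteq> {})"
    unfolding eviction_compatible_def FR_eq by blast
  also have "\<dots> \<longleftrightarrow> (\<forall>M' \<in> FR \<Lambda>. \<forall>M \<subseteq> M'. FRsubs M \<Lambda> \<noteq> {})"
  proof (intro ball_cong refl iffI allI impI)
    fix M' M
    assume "M' \<in> FR \<Lambda>" and evict: "\<forall>N \<subseteq> models \<Lambda>. FRsubs (M' - N) \<Lambda> \<noteq> {}" and "M \<subseteq> M'"
    \<comment> \<open>To obtain a given \<open>M\<close> inside \<open>M'\<close>, the set to evict
      is its relative complement \<open>M' - M\<close>.\<close>
    then have "M' - (M' - M) = M" and "M' - M \<subseteq> models \<Lambda>"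
      using FR_subset_models by blast+
    with evict show "FRsubs M \<Lambda> \<noteq> {}" by metis
  qed blast
  also have "\<dots> \<longleftrightarrow> (\<forall>M \<subseteq> models \<Lambda>. (\<exists>M' \<in> FR \<Lambda>. M \<subseteq> M') \<longrightarrow> FRsubs M \<Lambda> \<noteq> {})"
    by (meson FR_subset_models subset_trans)
  finally show ?thesis .
qed

lemma reception_compatible_iff:
  "reception_compatible \<Lambda> \<longleftrightarrow>
     (\<forall>M \<subseteq> models \<Lambda>. (\<exists>M' \<in> FR \<Lambda>. M' \<subseteq> M) \<longrightarrow> FRsups M \<Lambda> \<noteq> {})"
proof -
  have "reception_compatible \<Lambda> \<longleftrightarrow>
      (\<forall>M' \<in> FR \<Lambda>. \<forall>N \<subseteq> models \<Lambda>. FRsups (M' \<union> N) \<Lambda> \<noteq> {})"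
    unfolding reception_compatible_def FR_eq by blast
  also have "\<dots> \<longleftrightarrow> (\<forall>M \<subseteq> models \<Lambda>. (\<exists>M' \<in> FR \<Lambda>. M' \<subseteq> M) \<longrightarrow> FRsups M \<Lambda> \<noteq> {})"
    \<comment> \<open>A set \<open>M\<close> of models including \<open>M'\<close> is
      \<open>M' \<union> M\<close>, so \<open>N = M\<close> serves as witness; conversely
      \<open>M' \<union> N\<close> is a set of models that includes \<open>M'\<close>.\<close>
    by (metis FR_subset_models Un_absorb1 Un_least Un_upper1)
  finally show ?thesis .
qed

theorem theorem3:
  fixes \<Lambda> :: "('f, 'm) sat_system"
  assumes "satisfaction_system \<Lambda>"
  shows "(eviction_compatible \<Lambda> \<longleftrightarrow>
           (\<forall>M. M \<subseteq> models \<Lambda> \<longrightarrow>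
              M \<in> FR \<Lambda>
            \<or> (\<exists>X. immediate_predecessor (FR \<Lambda> \<union> {M}) (\<subset>) X M)
            \<or> \<not> (\<exists>M' \<in> FR \<Lambda>. M \<subseteq> M')))
       \<and> (reception_compatible \<Lambda> \<longleftrightarrow>
           (\<forall>M. M \<subseteq> models \<Lambda> \<longrightarrow>
              M \<in> FR \<Lambda>
            \<or> (\<exists>Z. immediate_successor (FR \<Lambda> \<union> {M}) (\<subset>) Z M)
            \<or> \<not> (\<exists>M' \<in> FR \<Lambda>. M' \<subseteq> M)))"
  \<comment> \<open>After rewriting, condition (iii) is the negated premise of the implication that
    expresses compatibility, and only propositional reasoning remains.\<close>
  unfolding eviction_compatible_iff reception_compatible_iff
    FRsubs_nonempty_iff FRsups_nonempty_iff
  by blast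

end
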